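(* Let $(X,d)$ be a metric space and let $(K,\varrho)$ be an infinite compact metric space. Then $\mathcal A(X,C(K))=\mathcal A(X,c)$.
   Context: $c$ denotes the space of all real converging sequences, equipped with the supremum norm. $C(K)$ is the space of all real valued continuous functions on $K$, equipped with the supremum norm. For metric spaces $(X,d)$, $(Y,\sigma)$, $\alpha\in(0,1]$ and $L>0$, a map $f:X\to Y$ is called $(L,\alpha)$-Hölder if $\sigma(f(x),f(y))\le L d(x,y)^\alpha$ for all $x,y\in X$. $\mathcal A(X,Y)$ denotes the set of all $\alpha\in(0,1]$ such that for every $L>0$ and every subset $M\subset X$, any $(L,\alpha)$-Hölder function $f:M\to Y$ can be extended to an $(L,\alpha)$-Hölder function from $X$ into $Y$ (same constant $L$). Normed spaces are viewed as metric spaces with the norm distance. *)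

theory Defs
  imports "HOL-Analysis.Analysis"
begin

definition holder_map ::
  "real \<Rightarrow> real \<Rightarrow> 'a::metric_space set \<Rightarrow> 'b::metric_space set \<Rightarrow> ('a \<Rightarrow> 'b) \<Rightarrow> bool" where
  "holder_map L \<alpha> M Y f \<longleftrightarrow>
     f \<in> M \<rightarrow> Y \<and> (\<forall>x\<in>M. \<forall>y\<in>M. dist (f x) (f y) \<le> L * dist x y powr \<alpha>)"

text \<open>
  Metric spaces are subsets of types of class \<open>metric_space\<close>, with the induced metric (so the
  empty space is allowed). The extension keeps the constant \<open>L\<close>.
\<close>

definition holder_ext_exponents :: "'a::metric_space set \<Rightarrow> 'b::metric_space set \<Rightarrow> real set" where
  "holder_ext_exponents X Y =
     {\<alpha> \<in> {0<..1}. \<forall>L>0. \<forall>M\<subseteq>X. \<forall>f. holder_map L \<alpha> M Y f \<longrightarrow>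
        (\<exists>g. holder_map L \<alpha> X Y g \<and> (\<forall>x\<in>M. g x = f x))}"

text \<open>
  As \<open>nat\<close> is discrete, the type of bounded continuous functions from \<open>nat\<close> to \<open>real\<close> is the
  space of all bounded real sequences with the supremum norm; the space \<open>c\<close> is a subspace of it.
  By \<open>convergent_in_bcontfun\<close> no convergent sequence is lost.
\<close>

definition convergent_seqs :: "(nat \<Rightarrow>\<^sub>C real) set" where
  "convergent_seqs = {x. convergent (apply_bcontfun x)}"

lemma convergent_in_bcontfun:
  fixes s :: "nat \<Rightarrow> real"
  assumes "convergent s"
  shows "s \<in> bcontfun"
  using convergent_imp_bounded[of s] assms
  by (auto simp: bcontfun_def convergent_def)

text \<open>
  Likewise, over a compact space \<open>K\<close> the type of bounded continuous real functions consists of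
  all continuous real functions, so that it is \<open>C(K)\<close> with the supremum norm.
\<close>

lemma continuous_in_bcontfun:
  fixes f :: "'k::metric_space \<Rightarrow> real"
  assumes "compact (UNIV :: 'k set)" and "continuous_on UNIV f"
  shows "f \<in> bcontfun"
  using assms by (auto simp: bcontfun_def intro: compact_imp_bounded compact_continuous_image)

end

theory Submission
  imports Defs
begin

text \<open>
  Restriction to a sequence converging to a limit point of \<open>K\<close> and a nonexpansive right inverse of it
  make \<open>c\<close> a nonexpansive retract of \<open>C(K)\<close>, so extension exponents pass from \<open>C(K)\<close> to \<open>c\<close>.

  Conversely, Zorn's lemma reduces extension into \<open>C(K)\<close> to adding one point \<open>x\<close>, that is, to finding
  a continuous \<open>g\<close> with \<open>f a k - r a \<le> g k \<le> f a k + r a\<close> for all \<open>a\<close>, where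
  \<open>r a = L * dist a x powr \<alpha>\<close>. The only obstruction is that the lower bounds at some points \<open>y n\<close>
  exceed the upper bounds at points \<open>z n\<close> by a fixed amount while \<open>y n\<close> and \<open>z n\<close> tend to the
  same limit. Restricting \<open>f\<close> to the interleaved sequence gives a map into \<open>c\<close>, whose extension to
  \<open>x\<close> excludes this.
\<close>

section \<open>Reduction to one-point extensions\<close>

lemma convergent_bcontfun_inverse:
  fixes s :: "nat \<Rightarrow> real"
  assumes "convergent s"
  shows "apply_bcontfun (Bcontfun s) = s"
  using convergent_in_bcontfun[OF assms] by (rule Bcontfun_inverse)

lemma holder_ext_exponentsD:
  assumes "\<alpha> \<in> holder_ext_exponents X Y" "L > 0" "M \<subseteq> X" "holder_map L \<alpha> M Y f"
  shows "\<exists>g. holder_map L \<alpha> X Y g \<and> (\<forall>x\<in>M. g x = f x)"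
  using assms by (simp add: holder_ext_exponents_def)

text \<open>Zorn's lemma is applied to graphs, so that an upper bound of a chain is its plain union:
  any two pairs of the union lie in one member of the chain. A maximal graph has full domain because
  \<open>point\<close> would otherwise adjoin another pair.\<close>

lemma holder_extension_by_points:
  assumes point: "\<And>A h x. A \<subseteq> X \<Longrightarrow> holder_map L \<alpha> A Y h \<Longrightarrow> x \<in> X \<Longrightarrow>
      \<exists>v\<in>Y. \<forall>a\<in>A. dist (h a) v \<le> L * dist a x powr \<alpha>"
    and "M \<subseteq> X" and f: "holder_map L \<alpha> M Y f"
  shows "\<exists>g. holder_map L \<alpha> X Y g \<and> (\<forall>x\<in>M. g x = f x)"
proof -
  define Gs where "Gs = {G. (\<lambda>x. (x, f x)) ` M \<subseteq> G \<and> G \<subseteq> X \<times> Y \<and>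
    (\<forall>x u y v. (x, u) \<in> G \<longrightarrow> (y, v) \<in> G \<longrightarrow> dist u v \<le> L * dist x y powr \<alpha>)}"
  have "\<exists>G\<in>Gs. \<forall>H\<in>Gs. G \<subseteq> H \<longrightarrow> H = G"
  proof (rule subset_Zorn_nonempty)
    show "Gs \<noteq> {}"
      using f \<open>M \<subseteq> X\<close> by (auto simp: Gs_def holder_map_def intro!: exI[of _ "(\<lambda>x. (x, f x)) ` M"])
    show "\<Union>\<C> \<in> Gs" if ne: "\<C> \<noteq> {}" and ch: "subset.chain Gs \<C>" for \<C>
    proof -
      have sub: "\<C> \<subseteq> Gs" and lin: "\<And>G H. G \<in> \<C> \<Longrightarrow> H \<in> \<C> \<Longrightarrow> G \<subseteq> H \<or> H \<subseteq> G"
        using ch by (auto simp: subset.chain_def)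
      have "dist u v \<le> L * dist x y powr \<alpha>"
        if GH: "G \<in> \<C>" "(x, u) \<in> G" "H \<in> \<C>" "(y, v) \<in> H" for x u y v G H
      proof -
        obtain F where "F \<in> \<C>" "(x, u) \<in> F" "(y, v) \<in> F"
          using lin[OF GH(1,3)] GH by blast
        then show ?thesis
          using sub unfolding Gs_def by blast
      qed
      moreover have "(\<lambda>x. (x, f x)) ` M \<subseteq> \<Union>\<C>" "\<Union>\<C> \<subseteq> X \<times> Y"
        using ne sub unfolding Gs_def by blast+
      ultimately show ?thesis
        unfolding Gs_def by blast
    qed
  qed
  then obtain G where G: "G \<in> Gs" and max: "\<And>H. H \<in> Gs \<Longrightarrow> G \<subseteq> H \<Longrightarrow> H = G"
    by blast
  have fG: "(x, f x) \<in> G" if "x \<in> M" for x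
    using G that by (auto simp: Gs_def)
  have XY: "x \<in> X" "u \<in> Y" if "(x, u) \<in> G" for x u
    using G that by (auto simp: Gs_def)
  have hG: "dist u v \<le> L * dist x y powr \<alpha>" if "(x, u) \<in> G" "(y, v) \<in> G" for x u y v
    using G that unfolding Gs_def by blast
  \<comment> \<open>For equal arguments the Hoelder bound is 0, so every member of \<open>Gs\<close>
    is the graph of a function.\<close>
  have uniq: "u = v" if "(x, u) \<in> G" "(x, v) \<in> G" for x u v
    using hG[OF that] by simp
  define g where "g x = (THE u. (x, u) \<in> G)" for x
  have g: "g x = u" if "(x, u) \<in> G" for x u
    unfolding g_def using that uniq by blast
  have dom: "x \<in> fst ` G" if "x \<in> X" for x
  proof -
    have "holder_map L \<alpha> (fst ` G) Y g"
      using hG XY by (force simp: holder_map_def g)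
    then obtain v where v: "v \<in> Y" "\<forall>a\<in>fst ` G. dist (g a) v \<le> L * dist a x powr \<alpha>"
      using point[of "fst ` G" g x] \<open>x \<in> X\<close> XY by force
    have near: "dist u v \<le> L * dist a x powr \<alpha>" if "(a, u) \<in> G" for a u
      using v(2) g[OF that] that by force
    have near': "dist v u \<le> L * dist x a powr \<alpha>" if "(a, u) \<in> G" for a u
      using near[OF that] by (simp add: dist_commute)
    have "insert (x, v) G \<in> Gs"
      using G v(1) \<open>x \<in> X\<close> unfolding Gs_def by (auto intro: near near' hG)
    then have "(x, v) \<in> G"
      using max[of "insert (x, v) G"] by blast
    then show ?thesis by force
  qed
  have gX: "(x, g x) \<in> G" if "x \<in> X" for x
    using dom[OF that] g by force
  have "holder_map L \<alpha> X Y g"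
    using gX hG XY(2)[OF gX] by (auto simp: holder_map_def)
  then show ?thesis
    using fG g by blast
qed

section \<open>Continuous functions between lower and upper bounds\<close>

text \<open>
  The infimum of the upper bounds enlarged by the modulus \<open>\<omega> t = (INF e>0. e + C e * t)\<close>; an infimum
  of affine functions with nonnegative coefficients is subadditive, so \<open>\<omega>\<close> is a modulus of continuity
  for it.
\<close>

lemma uniformly_continuous_insertion:
  fixes l u :: "'i \<Rightarrow> 'k::metric_space \<Rightarrow> real"
  assumes "A \<noteq> {}"
    and gap: "\<And>e. e > 0 \<Longrightarrow> \<exists>C\<ge>0. \<forall>a\<in>A. \<forall>b\<in>A. \<forall>y z. l a y \<le> u b z + e + C * dist y z"
  shows "\<exists>g. uniformly_continuous_on UNIV g \<and> (\<forall>a\<in>A. \<forall>k. l a k \<le> g k \<and> g k \<le> u a k)"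
proof -
  obtain C where C0: "\<And>e. e > 0 \<Longrightarrow> C e \<ge> 0"
    and C: "\<And>e a b y z. \<lbrakk>e > 0; a \<in> A; b \<in> A\<rbrakk> \<Longrightarrow> l a y \<le> u b z + e + C e * dist y z"
    using gap by metis
  define S where "S k = {u b z + e + C e * dist k z |b z e. b \<in> A \<and> e > 0}" for k
  define g where "g k = Inf (S k)" for k
  have ne: "S k \<noteq> {}" for k
    using \<open>A \<noteq> {}\<close> zero_less_one unfolding S_def by blast
  have lS: "l a k \<le> s" if "a \<in> A" "s \<in> S k" for a k s
    using that C by (auto simp: S_def)
  have bdd: "bdd_below (S k)" for k
    using \<open>A \<noteq> {}\<close> lS by (meson bdd_belowI ex_in_conv)
  have lg: "l a k \<le> g k" if "a \<in> A" for a k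
    unfolding g_def using ne lS[OF that] by (rule cInf_greatest)
  have gle: "g k \<le> u b z + e + C e * dist k z" if "b \<in> A" "e > 0" for b z e k
    unfolding g_def using that by (intro cInf_lower bdd) (auto simp: S_def)
  have gu: "g k \<le> u a k" if "a \<in> A" for a k
  proof (rule field_le_epsilon)
    fix e :: real assume "e > 0"
    then show "g k \<le> u a k + e"
      using gle[OF that, of e k k] by simp
  qed
  have mod: "g k \<le> g k' + e + C e * dist k k'" if "e > 0" for e k k'
  proof -
    have "g k - e - C e * dist k k' \<le> s" if "s \<in> S k'" for s
    proof -
      obtain b z e' where s: "s = u b z + e' + C e' * dist k' z" and b: "b \<in> A" and e': "e' > 0"
        using \<open>s \<in> S k'\<close> by (auto simp: S_def)
      have tri: "dist k z \<le> dist k k' + dist k' z"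
        by (rule dist_triangle)
      show ?thesis
      \<comment> \<open>The smaller of the two slopes is used to move from \<open>k'\<close> to
        \<open>k\<close>. If it is \<open>C e'\<close>, the element of \<open>S k\<close> with the
        same \<open>b\<close>, \<open>z\<close>, \<open>e'\<close> bounds \<open>g k\<close>, and
        the move costs at most \<open>C e * dist k k'\<close>. Otherwise \<open>e'\<close> is
        replaced by \<open>e\<close>, which the summand \<open>e\<close> of the claim pays
        for.\<close>
      proof (cases "C e' \<le> C e")
        case True
        have "C e' * dist k z \<le> C e' * dist k k' + C e' * dist k' z"
          using mult_left_mono[OF tri C0[OF e']] by (simp add: algebra_simps)
        moreover have "C e' * dist k k' \<le> C e * dist k k'"
          using True by (simp add: mult_right_mono)
        ultimately show ?thesis
          using gle[OF b e', of k z] s \<open>e > 0\<close> by linarith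
      next
        case False
        have "C e * dist k z \<le> C e * dist k k' + C e * dist k' z"
          using mult_left_mono[OF tri C0[OF \<open>e > 0\<close>]] by (simp add: algebra_simps)
        moreover have "C e * dist k' z \<le> C e' * dist k' z"
          using False by (simp add: mult_right_mono)
        ultimately show ?thesis
          using gle[OF b \<open>e > 0\<close>, of k z] s e' by linarith
      qed
    qed
    then have "g k - e - C e * dist k k' \<le> g k'"
      unfolding g_def[of k'] using ne by (intro cInf_greatest)
    then show ?thesis by simp
  qed
  have "uniformly_continuous_on UNIV g"
    unfolding uniformly_continuous_on_def
  proof (intro allI impI)
    fix e :: real assume "e > 0"
    define c where "c = C (e / 2)"
    have c0: "c \<ge> 0" using C0 \<open>e > 0\<close> by (simp add: c_def)
    \<comment> \<open>The denominator has \<open>c + 1\<close> instead of \<open>c\<close> so that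
      the radius stays positive when \<open>c = 0\<close>.\<close>
    have "dist (g k') (g k) < e" if "dist k' k < e / (2 * (c + 1))" for k k'
    proof -
      have "c * dist k' k \<le> (c + 1) * dist k' k"
        by (simp add: mult_right_mono)
      also have "\<dots> < e / 2"
        using that c0 by (simp add: field_simps)
      finally have "c * dist k' k < e / 2" .
      then show ?thesis
        using mod[of "e / 2" k k'] mod[of "e / 2" k' k] \<open>e > 0\<close>
        by (simp add: dist_real_def c_def[symmetric] dist_commute abs_less_iff)
    qed
    moreover have "e / (2 * (c + 1)) > 0"
      using \<open>e > 0\<close> c0 by simp
    ultimately show "\<exists>d>0. \<forall>x\<in>UNIV. \<forall>x'\<in>UNIV. dist x' x < d \<longrightarrow> dist (g x') (g x) < e"
      by blast
  qed
  then show ?thesis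
    using lg gu by blast
qed

section \<open>One-point extension into C(K) from convergent sequences\<close>

lemma interleave_LIMSEQ:
  assumes "y \<longlonglongrightarrow> p" "z \<longlonglongrightarrow> p"
  shows "(\<lambda>n. if even n then y (n div 2) else z (n div 2)) \<longlonglongrightarrow> p"
proof (rule topological_tendstoI)
  fix S assume "open S" "p \<in> S"
  then have "\<forall>\<^sub>F n in sequentially. y n \<in> S \<and> z n \<in> S"
    using assms by (simp add: eventually_conj topological_tendstoD)
  then obtain N where N: "\<And>n. n \<ge> N \<Longrightarrow> y n \<in> S \<and> z n \<in> S"
    by (auto simp: eventually_sequentially)
  then have "\<forall>n\<ge>2 * N. (if even n then y (n div 2) else z (n div 2)) \<in> S"
    using N by auto
  then show "\<forall>\<^sub>F n in sequentially. (if even n then y (n div 2) else z (n div 2)) \<in> S"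
    unfolding eventually_sequentially ..
qed

text \<open>The hypothesis \<open>seq\<close> is used twice: constant sequences make the bounds
  compatible at each single point, and interleaved sequences give the hypothesis \<open>gap\<close>
  of \<open>uniformly_continuous_insertion\<close>. Compactness supplies the common limit.\<close>

lemma point_extension_from_sequences:
  fixes f :: "'a \<Rightarrow> 'k::metric_space \<Rightarrow>\<^sub>C real"
  assumes K: "compact (UNIV :: 'k set)"
    and seq: "\<And>w p. w \<longlonglongrightarrow> p \<Longrightarrow> \<exists>s. convergent s \<and> (\<forall>a\<in>A. \<forall>n. \<bar>f a (w n) - s n\<bar> \<le> r a)"
  shows "\<exists>v. \<forall>a\<in>A. dist (f a) v \<le> r a"
proof (cases "A = {}")
  case False
  then obtain a0 where a0: "a0 \<in> A" by blast
  have pw: "f a k - f b k \<le> r a + r b" if "a \<in> A" "b \<in> A" for a b k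
  proof -
    obtain s where "\<forall>a\<in>A. \<bar>f a k - s (0::nat)\<bar> \<le> r a"
      using seq[of "\<lambda>_. k" k] by auto
    then have "\<bar>f a k - s 0\<bar> \<le> r a" "\<bar>f b k - s 0\<bar> \<le> r b"
      using that by auto
    then show ?thesis by linarith
  qed
  have gap: "\<exists>C\<ge>0. \<forall>a\<in>A. \<forall>b\<in>A. \<forall>y z. f a y - r a \<le> f b z + r b + e + C * dist y z"
    if "e > 0" for e
  proof (rule ccontr)
    assume "\<not> ?thesis"
    then have "\<exists>a\<in>A. \<exists>b\<in>A. \<exists>y z. f a y - r a > f b z + r b + e + C * dist y z" if "C \<ge> 0" for C
      using that by (meson not_le)
    \<comment> \<open>Failure for one \<open>e\<close> and every slope is used along the slopes
      \<open>real n\<close>, which will force \<open>y n\<close> and \<open>z n\<close>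
      together.\<close>
    then have "\<forall>n. \<exists>a\<in>A. \<exists>b\<in>A. \<exists>y z. f a y - r a > f b z + r b + e + real n * dist y z"
      by simp
    then obtain a b y z where ab: "\<And>n. a n \<in> A" "\<And>n. b n \<in> A"
      and bad: "\<And>n. f (a n) (y n) - r (a n) > f (b n) (z n) + r (b n) + e + real n * dist (y n) (z n)"
      by metis
    \<comment> \<open>The functions \<open>f (a n)\<close> and \<open>f (b n)\<close> vary with
      \<open>n\<close> and need not be uniformly bounded. Comparing both with the fixed
      \<open>f a0\<close> through \<open>pw\<close> yields a bound independent of
      \<open>n\<close>.\<close>
    define D where "D = 2 * (norm (f a0) + r a0)"
    have D: "real n * dist (y n) (z n) \<le> D" for n
      using bad[of n] pw[OF ab(1) a0, of n "y n"] pw[OF a0 ab(2), of "z n" n]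
        norm_bounded[of "f a0" "y n"] norm_bounded[of "f a0" "z n"] \<open>e > 0\<close>
      by (simp add: D_def abs_le_iff)
    have "(\<lambda>n. dist (y n) (z n)) \<longlonglongrightarrow> 0"
    proof (rule tendsto_sandwich[OF _ _ tendsto_const])
      show "\<forall>\<^sub>F n in sequentially. dist (y n) (z n) \<le> D / real n"
        using eventually_gt_at_top[of 0] by eventually_elim (use D in \<open>simp add: field_simps\<close>)
      show "(\<lambda>n. D / real n) \<longlonglongrightarrow> 0" by (rule lim_const_over_n)
    qed auto
    then have yz: "(\<lambda>n. dist (y (\<sigma> n)) (z (\<sigma> n))) \<longlonglongrightarrow> 0" if "strict_mono \<sigma>" for \<sigma>
      using LIMSEQ_subseq_LIMSEQ[OF _ that] by (simp add: comp_def)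
    obtain p \<sigma> where \<sigma>: "strict_mono (\<sigma> :: nat \<Rightarrow> nat)" "(y \<circ> \<sigma>) \<longlonglongrightarrow> p"
      using seq_compactE[OF compact_imp_seq_compact[OF K], of y] UNIV_I by metis
    have "(\<lambda>n. dist (z (\<sigma> n)) p) \<longlonglongrightarrow> 0"
    proof (rule tendsto_sandwich[OF _ _ tendsto_const])
      show "(\<lambda>n. dist (y (\<sigma> n)) (z (\<sigma> n)) + dist (y (\<sigma> n)) p) \<longlonglongrightarrow> 0"
        using tendsto_add[OF yz[OF \<sigma>(1)] iffD1[OF tendsto_dist_iff \<sigma>(2)]] by (simp add: comp_def)
    qed (auto intro!: always_eventually dist_triangle3)
    then have "(z \<circ> \<sigma>) \<longlonglongrightarrow> p"
      by (subst tendsto_dist_iff) (simp add: comp_def)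
    define w where "w n = (if even n then (y \<circ> \<sigma>) (n div 2) else (z \<circ> \<sigma>) (n div 2))" for n
    have "w \<longlonglongrightarrow> p"
      unfolding w_def using \<sigma>(2) \<open>(z \<circ> \<sigma>) \<longlonglongrightarrow> p\<close> by (rule interleave_LIMSEQ)
    then obtain s where "convergent s" and s: "\<And>a n. a \<in> A \<Longrightarrow> \<bar>f a (w n) - s n\<bar> \<le> r a"
      using seq by blast
    then obtain q where q: "s \<longlonglongrightarrow> q" by (auto simp: convergent_def)
    \<comment> \<open>Even terms of \<open>s\<close> lie above the lower bounds at
      \<open>y (\<sigma> n)\<close>, odd terms below the upper bounds at
      \<open>z (\<sigma> n)\<close>. The violated inequality keeps them \<open>e\<close> apart,
      although \<open>s\<close> converges.\<close>
    have "s (2 * n) - s (2 * n + 1) \<ge> e" for n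
    proof -
      have "real (\<sigma> n) * dist (y (\<sigma> n)) (z (\<sigma> n)) \<ge> 0" by simp
      moreover have "w (2 * n) = y (\<sigma> n)" "w (2 * n + 1) = z (\<sigma> n)"
        by (simp_all add: w_def)
      ultimately show ?thesis
        using bad[of "\<sigma> n"] s[OF ab(1), of "\<sigma> n" "2 * n"] s[OF ab(2), of "\<sigma> n" "2 * n + 1"]
        by (simp only: abs_le_iff) linarith
    qed
    moreover have "(\<lambda>n. s (2 * n) - s (2 * n + 1)) \<longlonglongrightarrow> q - q"
      by (intro tendsto_diff filterlim_compose[OF q] filterlim_subseq) (auto intro: strict_monoI)
    ultimately have "q - q \<ge> e"
      by (intro LIMSEQ_le_const) auto
    with \<open>e > 0\<close> show False by simp
  qed
  obtain g where "uniformly_continuous_on UNIV g"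
    and g: "\<forall>a\<in>A. \<forall>k. f a k - r a \<le> g k \<and> g k \<le> f a k + r a"
    using uniformly_continuous_insertion[OF False, of "\<lambda>a k. f a k - r a" "\<lambda>a k. f a k + r a"] gap
    by blast
  then have "g \<in> bcontfun"
    using K by (intro continuous_in_bcontfun uniformly_continuous_imp_continuous)
  then have "\<forall>a\<in>A. dist (f a) (Bcontfun g) \<le> r a"
    using g by (auto intro!: dist_bound simp: Bcontfun_inverse dist_real_def abs_le_iff algebra_simps)
  then show ?thesis ..
qed simp

section \<open>The space c as a nonexpansive retract of C(K)\<close>

text \<open>The ratio 3 makes the open annuli around \<open>p\<close> with radii 1/2 and 3/2 times
  \<open>dist (k n) p\<close> pairwise disjoint; they will carry the tent functions.\<close>

lemma geometric_sequence_to_limit_point: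
  fixes p :: "'k::metric_space"
  assumes "p islimpt UNIV"
  obtains k where "\<And>n. k n \<noteq> p" "\<And>n. 3 * dist (k (Suc n)) p \<le> dist (k n) p" "k \<longlonglongrightarrow> p"
proof -
  have near: "\<exists>x. x \<noteq> p \<and> dist x p < e" if "e > 0" for e
    using assms that by (auto simp: islimpt_approachable)
  have "\<exists>k. \<forall>n. k n \<noteq> p \<and> 3 * dist (k (Suc n)) p \<le> dist (k n) p"
  proof (rule dependent_nat_choice)
    show "\<exists>x. x \<noteq> p" using near[of 1] by auto
    show "\<exists>y. y \<noteq> p \<and> 3 * dist y p \<le> dist x p" if "x \<noteq> p" for x and n :: nat
      using near[of "dist x p / 3"] that by (auto intro!: less_imp_le)
  qed
  then obtain k where k: "\<And>n. k n \<noteq> p" "\<And>n. 3 * dist (k (Suc n)) p \<le> dist (k n) p"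
    by blast
  have bound: "dist (k n) p \<le> dist (k 0) p * (1 / 3) ^ n" for n
  proof (induction n)
    case (Suc n)
    then show ?case using k(2)[of n] by simp
  qed simp
  have "(\<lambda>n. dist (k n) p) \<longlonglongrightarrow> 0"
  proof (rule tendsto_sandwich[OF _ _ tendsto_const])
    show "(\<lambda>n. dist (k 0) p * (1 / 3) ^ n) \<longlonglongrightarrow> 0"
      by (intro tendsto_mult_right_zero LIMSEQ_realpow_zero) auto
  qed (use bound in auto)
  then have "k \<longlonglongrightarrow> p"
    by (rule iffD2[OF tendsto_dist_iff])
  with k that show ?thesis by blast
qed

text \<open>
  A convergent sequence prescribed on points \<open>k n\<close> approaching \<open>p\<close> geometrically extends
  continuously, and the extension is a nonexpansive function of the sequence: its values are convex
  combinations of the limit and of one term, with weight a tent function of the distance to \<open>p\<close>.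
\<close>

lemma nonexpansive_extension_operator:
  fixes k :: "nat \<Rightarrow> 'k::metric_space"
  assumes ne: "\<And>n. k n \<noteq> p" and decr: "\<And>n. 3 * dist (k (Suc n)) p \<le> dist (k n) p"
  obtains E :: "(nat \<Rightarrow> real) \<Rightarrow> 'k \<Rightarrow> real"
  where "\<And>s. convergent s \<Longrightarrow> continuous_on UNIV (E s)" "\<And>s n. E s (k n) = s n"
    "\<And>s t b x. \<lbrakk>convergent s; convergent t; \<And>n. \<bar>s n - t n\<bar> \<le> b\<rbrakk> \<Longrightarrow> \<bar>E s x - E t x\<bar> \<le> b"
proof -
  define d where "d n = dist (k n) p" for n
  have d0: "d n > 0" for n using ne by (simp add: d_def)
  have dd: "3 * d n \<le> d m" if "m < n" for m n
    using that
  proof (induction rule: less_Suc_induct)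
    case (1 i) then show ?case using decr by (simp add: d_def)
  next
    case (2 i j k) then show ?case using d0[of j] by linarith
  qed
  \<comment> \<open>A tent in the distance to \<open>p\<close>: height 1 at distance
    \<open>d n\<close>, and zero unless that distance lies strictly between \<open>d n / 2\<close>
    and \<open>3 * d n / 2\<close>.\<close>
  define \<phi> where "\<phi> n x = max 0 (1 - 2 * \<bar>dist x p - d n\<bar> / d n)" for n x
  have \<phi>01: "0 \<le> \<phi> n x" "\<phi> n x \<le> 1" for n x
    using d0[of n] by (auto simp: \<phi>_def)
  have supp: "d n < 2 * dist x p \<and> 2 * dist x p < 3 * d n" if "\<phi> n x \<noteq> 0" for n x
  proof -
    have "2 * \<bar>dist x p - d n\<bar> / d n < 1"
    proof (rule ccontr)
      assume "\<not> ?thesis"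
      then have "\<phi> n x = 0" unfolding \<phi>_def by (intro max_absorb1) linarith
      with that show False by contradiction
    qed
    then have "2 * \<bar>dist x p - d n\<bar> < d n"
      using d0[of n] by (simp add: field_simps)
    then show ?thesis by (auto simp: abs_if split: if_splits)
  qed
  have disj: "m = n" if "\<phi> m x \<noteq> 0" "\<phi> n x \<noteq> 0" for m n x
  proof (rule ccontr)
    assume "m \<noteq> n"
    then have "3 * d n \<le> d m \<or> 3 * d m \<le> d n" using dd by (meson linorder_neqE_nat)
    then show False using supp[OF that(1)] supp[OF that(2)] by linarith
  qed
  have \<phi>k: "\<phi> n (k n) = 1" for n by (simp add: \<phi>_def d_def)
  have \<phi>cont: "continuous_on UNIV (\<phi> n)" for n
    unfolding \<phi>_def using d0[of n] by (intro continuous_intros) auto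
  \<comment> \<open>By \<open>disj\<close> at most one tent is nonzero at \<open>x\<close>, and
    \<open>j x\<close> selects it. The default 0 is harmless: all tents then vanish at
    \<open>x\<close>, so \<open>E s x\<close> below is \<open>lim s\<close>.\<close>
  define j where "j x = (if \<exists>n. \<phi> n x \<noteq> 0 then SOME n. \<phi> n x \<noteq> 0 else 0)" for x
  have j: "\<phi> n x = 0" if "n \<noteq> j x" for n x
    using disj that unfolding j_def by (metis (mono_tags, lifting) someI_ex)
  define E where "E s x = lim s + (s (j x) - lim s) * \<phi> (j x) x" for s x
  have "continuous_on UNIV (E s)" if "convergent s" for s
  proof (rule uniform_limit_theorem)
    \<comment> \<open>Continuity of \<open>E s\<close> comes from uniform convergence of these
      finite sums: \<open>P N\<close> differs from \<open>E s\<close> at \<open>x\<close> only if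
      \<open>j x \<ge> N\<close>, and then by at most the distance from \<open>s (j x)\<close> to
      \<open>lim s\<close>.\<close>
    define P where "P N x = lim s + (\<Sum>n<N. (s n - lim s) * \<phi> n x)" for N x
    show "\<forall>\<^sub>F N in sequentially. continuous_on UNIV (P N)"
      unfolding P_def by (intro always_eventually allI continuous_intros \<phi>cont)
    show "uniform_limit UNIV P (E s) sequentially"
    proof (rule uniform_limitI)
      fix e :: real assume "e > 0"
      moreover have "s \<longlonglongrightarrow> lim s" using that by (simp add: convergent_LIMSEQ_iff)
      ultimately obtain N0 where N0: "\<And>n. n \<ge> N0 \<Longrightarrow> \<bar>s n - lim s\<bar> < e"
        by (auto simp: LIMSEQ_iff)
      have "dist (P N x) (E s x) < e" if "N \<ge> N0" for N x
      proof -
        have "(\<Sum>n<N. (s n - lim s) * \<phi> n x)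
            = (\<Sum>n<N. if n = j x then (s (j x) - lim s) * \<phi> (j x) x else 0)"
          using j by (intro sum.cong) auto
        then have P: "P N x = (if j x < N then E s x else lim s)"
          by (simp add: P_def E_def)
        show ?thesis
        proof (cases "j x < N")
          case False
          have "\<bar>s (j x) - lim s\<bar> * \<phi> (j x) x \<le> \<bar>s (j x) - lim s\<bar>"
            using \<phi>01 by (simp add: mult_left_le)
          also have "\<dots> < e" using N0 False that by simp
          finally show ?thesis
            using False \<phi>01 by (simp add: P E_def dist_real_def abs_mult)
        qed (simp add: P \<open>e > 0\<close>)
      qed
      then show "\<forall>\<^sub>F N in sequentially. \<forall>x\<in>UNIV. dist (P N x) (E s x) < e"
        by (auto simp: eventually_sequentially)
    qed
  qed simp
  moreover have "E s (k n) = s n" for s n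
  proof -
    have "j (k n) = n" using j[of n "k n"] \<phi>k[of n] by force
    then show ?thesis by (simp add: E_def \<phi>k)
  qed
  moreover have "\<bar>E s x - E t x\<bar> \<le> b"
    if "convergent s" "convergent t" and st: "\<And>n. \<bar>s n - t n\<bar> \<le> b" for s t b x
  proof -
    define c where "c = \<phi> (j x) x"
    have "(\<lambda>n. \<bar>s n - t n\<bar>) \<longlonglongrightarrow> \<bar>lim s - lim t\<bar>"
      using that by (intro tendsto_intros) (auto simp: convergent_LIMSEQ_iff)
    then have L: "\<bar>lim s - lim t\<bar> \<le> b"
      using st by (intro LIMSEQ_le_const2) auto
    have "E s x - E t x = (1 - c) * (lim s - lim t) + c * (s (j x) - t (j x))"
      by (simp add: E_def c_def algebra_simps)
    also have "\<bar>\<dots>\<bar> \<le> (1 - c) * \<bar>lim s - lim t\<bar> + c * \<bar>s (j x) - t (j x)\<bar>"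
      using \<phi>01[of "j x" x] by (intro order_trans[OF abs_triangle_ineq]) (simp add: c_def abs_mult)
    also have "\<dots> \<le> (1 - c) * b + c * b"
      using \<phi>01[of "j x" x] L st by (intro add_mono mult_left_mono) (auto simp: c_def)
    finally show ?thesis by (simp add: algebra_simps)
  qed
  ultimately show ?thesis using that by blast
qed

section \<open>Equality of the two sets of exponents\<close>

theorem theorem4p1:
  fixes X :: "'a::metric_space set"
  assumes "compact (UNIV :: 'k::metric_space set)"
    and "infinite (UNIV :: 'k set)"
  shows "holder_ext_exponents X (UNIV :: ('k \<Rightarrow>\<^sub>C real) set)
       = holder_ext_exponents X convergent_seqs"
proof (rule antisym; rule subsetI)
  fix \<alpha> assume \<alpha>: "\<alpha> \<in> holder_ext_exponents X (UNIV :: ('k \<Rightarrow>\<^sub>C real) set)"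
  obtain p :: 'k where "p islimpt UNIV"
    using Heine_Borel_imp_Bolzano_Weierstrass[OF assms subset_UNIV] by blast
  then obtain k where k: "\<And>n. k n \<noteq> p" "\<And>n. 3 * dist (k (Suc n)) p \<le> dist (k n) p" "k \<longlonglongrightarrow> p"
    using geometric_sequence_to_limit_point by blast
  obtain E :: "(nat \<Rightarrow> real) \<Rightarrow> 'k \<Rightarrow> real"
    where Ec: "\<And>s. convergent s \<Longrightarrow> continuous_on UNIV (E s)" and Ek: "\<And>s n. E s (k n) = s n"
      and El: "\<And>s t b x. \<lbrakk>convergent s; convergent t; \<And>n. \<bar>s n - t n\<bar> \<le> b\<rbrakk> \<Longrightarrow> \<bar>E s x - E t x\<bar> \<le> b"
    using nonexpansive_extension_operator[of k p, OF k(1) k(2)] by metis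
  \<comment> \<open>\<open>T\<close> embeds c into C(K) and \<open>R\<close> restricts to the points
    \<open>k n\<close>; \<open>Ek\<close> gives \<open>R (T s) = s\<close>. \<open>T\<close> is used
    only on \<open>convergent_seqs\<close>, where \<open>E s\<close> is continuous and
    \<open>Bcontfun\<close> returns the intended function.\<close>
  define T :: "(nat \<Rightarrow>\<^sub>C real) \<Rightarrow> ('k \<Rightarrow>\<^sub>C real)" where "T s = Bcontfun (E s)" for s
  define R :: "('k \<Rightarrow>\<^sub>C real) \<Rightarrow> (nat \<Rightarrow>\<^sub>C real)" where "R h = Bcontfun (\<lambda>n. h (k n))" for h
  have T: "apply_bcontfun (T s) = E s" if "s \<in> convergent_seqs" for s
    unfolding T_def using that Ec assms(1)
    by (intro Bcontfun_inverse continuous_in_bcontfun) (auto simp: convergent_seqs_def)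
  have conv: "convergent (\<lambda>n. apply_bcontfun h (k n))" for h :: "'k \<Rightarrow>\<^sub>C real"
    using continuous_on_tendsto_compose[OF continuous_on_apply_bcontfun[of UNIV h] k(3)]
    by (auto simp: convergent_def)
  have R: "apply_bcontfun (R h) = (\<lambda>n. h (k n))" for h
    unfolding R_def by (rule convergent_bcontfun_inverse[OF conv])
  have Tl: "dist (T s) (T t) \<le> dist s t" if "s \<in> convergent_seqs" "t \<in> convergent_seqs" for s t
    using that dist_bounded[of s _ t]
    by (intro dist_bound) (auto simp: T dist_real_def convergent_seqs_def intro!: El)
  have Rl: "dist (R g) (R h) \<le> dist g h" for g h
    by (intro dist_bound) (simp add: R dist_bounded)
  have "\<exists>g. holder_map L \<alpha> X convergent_seqs g \<and> (\<forall>x\<in>M. g x = f x)"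
    if "L > 0" "M \<subseteq> X" and f: "holder_map L \<alpha> M convergent_seqs f" for L M and f :: "'a \<Rightarrow> _"
  proof -
    have fc: "f x \<in> convergent_seqs" if "x \<in> M" for x
      using f that by (auto simp: holder_map_def)
    have "holder_map L \<alpha> M UNIV (T \<circ> f)"
      using f order_trans[OF Tl[OF fc fc]] by (simp add: holder_map_def)
    then obtain g where g: "holder_map L \<alpha> X UNIV g" "\<And>x. x \<in> M \<Longrightarrow> g x = T (f x)"
      using holder_ext_exponentsD[OF \<alpha> \<open>L > 0\<close> \<open>M \<subseteq> X\<close>, of "T \<circ> f"] by auto
    have "holder_map L \<alpha> X convergent_seqs (R \<circ> g)"
      using g(1) conv order_trans[OF Rl] by (simp add: holder_map_def convergent_seqs_def R)
    moreover have "(R \<circ> g) x = f x" if "x \<in> M" for x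
      using g(2)[OF that] fc[OF that] by (auto intro!: bcontfun_eqI simp: R T Ek)
    ultimately show ?thesis by blast
  qed
  then show "\<alpha> \<in> holder_ext_exponents X convergent_seqs"
    using \<alpha> by (auto simp: holder_ext_exponents_def)
next
  fix \<alpha> assume \<alpha>: "\<alpha> \<in> holder_ext_exponents X convergent_seqs"
  have "\<exists>g. holder_map L \<alpha> X UNIV g \<and> (\<forall>x\<in>M. g x = f x)"
    if "L > 0" and M: "M \<subseteq> X" and f: "holder_map L \<alpha> M UNIV f" for L M and f :: "'a \<Rightarrow> 'k \<Rightarrow>\<^sub>C real"
  proof (rule holder_extension_by_points[OF _ M f])
    fix A x and h :: "'a \<Rightarrow> 'k \<Rightarrow>\<^sub>C real"
    assume A: "A \<subseteq> X" "holder_map L \<alpha> A UNIV h" and "x \<in> X"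
    have "\<exists>s. convergent s \<and> (\<forall>a\<in>A. \<forall>n. \<bar>h a (w n) - s n\<bar> \<le> L * dist a x powr \<alpha>)"
      if w: "w \<longlonglongrightarrow> p" for w p
    proof -
      \<comment> \<open>Sampling \<open>h\<close> along \<open>w\<close> is nonexpansive and lands
        in c by continuity at \<open>p\<close>. The value at \<open>x\<close> of an extension of
        \<open>F\<close> is the required sequence \<open>s\<close>.\<close>
      define F where "F a = Bcontfun (\<lambda>n. h a (w n))" for a
      have conv: "convergent (\<lambda>n. apply_bcontfun (h a) (w n))" for a
        using continuous_on_tendsto_compose[OF continuous_on_apply_bcontfun[of UNIV "h a"] w]
        by (auto simp: convergent_def)
      have F: "apply_bcontfun (F a) = (\<lambda>n. h a (w n))" for a
        unfolding F_def by (rule convergent_bcontfun_inverse[OF conv])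
      have "dist (F a) (F b) \<le> dist (h a) (h b)" for a b
        by (intro dist_bound) (simp add: F dist_bounded)
      from order_trans[OF this] have "holder_map L \<alpha> A convergent_seqs F"
        using A(2) conv by (simp add: holder_map_def convergent_seqs_def F)
      then obtain G where G: "holder_map L \<alpha> X convergent_seqs G" "\<And>a. a \<in> A \<Longrightarrow> G a = F a"
        using holder_ext_exponentsD[OF \<alpha> \<open>L > 0\<close> A(1), of F] by auto
      have "\<bar>h a (w n) - G x n\<bar> \<le> L * dist a x powr \<alpha>" if "a \<in> A" for a n
      proof -
        have "\<bar>h a (w n) - G x n\<bar> \<le> dist (G a) (G x)"
          using dist_bounded[of "G a" n "G x"] G(2)[OF that] by (simp add: F dist_real_def)
        also have "\<dots> \<le> L * dist a x powr \<alpha>"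
          using G(1) that A(1) \<open>x \<in> X\<close> by (auto simp: holder_map_def)
        finally show ?thesis .
      qed
      moreover have "convergent (apply_bcontfun (G x))"
        using G(1) \<open>x \<in> X\<close> by (auto simp: holder_map_def convergent_seqs_def)
      ultimately show ?thesis by blast
    qed
    from point_extension_from_sequences[OF assms(1) this]
    show "\<exists>v\<in>UNIV. \<forall>a\<in>A. dist (h a) v \<le> L * dist a x powr \<alpha>"
      by simp
  qed
  then show "\<alpha> \<in> holder_ext_exponents X (UNIV :: ('k \<Rightarrow>\<^sub>C real) set)"
    using \<alpha> by (auto simp: holder_ext_exponents_def)
qed

end
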